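(* Let $C$ be a self-dual linear Kleinian code of length $n$ and let $h=\min\{\mathrm{wt}(\mathbf{x}):\mathbf{x}\in C'\}$ be the minimal weight of its shadow $C'$. Then $h\le n$, with equality if and only if $C$ is equivalent to $\gamma_1^n$.
   Context: Let $K=\{0,a,b,c\}$ be the Kleinian four-group. A linear code of length $n$ is a subgroup $C\subseteq K^n$; $\mathrm{wt}(\mathbf{x})$ is the number of nonzero coordinates. Define $x\cdot y\in\mathbb{F}_2$ for $x,y\in K$ by $x\cdot y=1$ iff $x,y$ are nonzero and distinct; $(\mathbf{x},\mathbf{y})=\sum_ix_i\cdot y_i$; $C^\perp=\{\mathbf{x}:(\mathbf{x},\mathbf{y})=0\ \forall \mathbf{y}\in C\}$; $C$ is self-dual if $C=C^\perp$, even if all codewords have even weight. For a self-dual $C$, let $C_0$ be the subcode of even-weight codewords; the shadow is $C'=C_0^\perp\setminus C$ if $C$ is not even and $C'=C$ if $C$ is even (in the latter case the zero word is included in the minimum defining $h$). $\gamma_1=\{(0),(a)\}$ and $\gamma_1^n$ is its $n$-fold direct product in $K^n$. Codes are equivalent if related by an element of $S_3^n\rtimes S_n$ acting by permuting coordinates and independently permuting $a,b,c$ in each coordinate. *)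

theory Defs
  imports
    Main
    "HOL-Library.Function_Algebras"
    "HOL-Library.Z2"
    "HOL-Combinatorics.Permutations"
begin

datatype klein = K0 | Ka | Kb | Kc

instantiation klein :: ab_group_add
begin

definition zero_klein :: klein where
  "0 = K0"

fun plus_klein :: "klein \<Rightarrow> klein \<Rightarrow> klein" where
  "K0 + y = y"
| "x + K0 = x"
| "Ka + Ka = K0" | "Ka + Kb = Kc" | "Ka + Kc = Kb"
| "Kb + Ka = Kc" | "Kb + Kb = K0" | "Kb + Kc = Ka"
| "Kc + Ka = Kb" | "Kc + Kb = Ka" | "Kc + Kc = K0"

definition uminus_klein :: "klein \<Rightarrow> klein" where
  "- x = (x :: klein)"

definition minus_klein :: "klein \<Rightarrow> klein \<Rightarrow> klein" where
  "x - y = (x + y :: klein)"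

instance
proof
  fix x y z :: klein
  show "x + y + z = x + (y + z)" by (cases x; cases y; cases z) simp_all
  show "x + y = y + x" by (cases x; cases y) simp_all
  show "0 + x = x" by (simp add: zero_klein_def)
  show "- x + x = 0" by (cases x) (simp_all add: zero_klein_def uminus_klein_def)
  show "x - y = x + - y" by (simp add: minus_klein_def uminus_klein_def)
qed

end

(* K^n is represented by the functions on nat vanishing outside {..<n}; zero and addition of words
   are the pointwise operations on functions. *)
definition words :: "nat \<Rightarrow> (nat \<Rightarrow> klein) set" where
  "words n = {x. \<forall>i\<ge>n. x i = 0}"

definition linear_code :: "nat \<Rightarrow> (nat \<Rightarrow> klein) set \<Rightarrow> bool" where
  "linear_code n C \<longleftrightarrow>
     C \<subseteq> words n \<and> 0 \<in> C \<and> (\<forall>x\<in>C. \<forall>y\<in>C. x + y \<in> C) \<and> (\<forall>x\<in>C. - x \<in> C)"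

definition wt :: "nat \<Rightarrow> (nat \<Rightarrow> klein) \<Rightarrow> nat" where
  "wt n x = card {i. i < n \<and> x i \<noteq> 0}"

definition klein_dot :: "klein \<Rightarrow> klein \<Rightarrow> bit" where
  "klein_dot x y = of_bool (x \<noteq> 0 \<and> y \<noteq> 0 \<and> x \<noteq> y)"

definition word_prod :: "nat \<Rightarrow> (nat \<Rightarrow> klein) \<Rightarrow> (nat \<Rightarrow> klein) \<Rightarrow> bit" where
  "word_prod n x y = (\<Sum>i<n. klein_dot (x i) (y i))"

definition dual_code :: "nat \<Rightarrow> (nat \<Rightarrow> klein) set \<Rightarrow> (nat \<Rightarrow> klein) set" where
  "dual_code n C = {x \<in> words n. \<forall>y\<in>C. word_prod n x y = 0}"

definition self_dual :: "nat \<Rightarrow> (nat \<Rightarrow> klein) set \<Rightarrow> bool" where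
  "self_dual n C \<longleftrightarrow> C = dual_code n C"

definition even_code :: "nat \<Rightarrow> (nat \<Rightarrow> klein) set \<Rightarrow> bool" where
  "even_code n C \<longleftrightarrow> (\<forall>x\<in>C. even (wt n x))"

definition even_subcode :: "nat \<Rightarrow> (nat \<Rightarrow> klein) set \<Rightarrow> (nat \<Rightarrow> klein) set" where
  "even_subcode n C = {x \<in> C. even (wt n x)}"

definition shadow :: "nat \<Rightarrow> (nat \<Rightarrow> klein) set \<Rightarrow> (nat \<Rightarrow> klein) set" where
  "shadow n C = (if even_code n C then C else dual_code n (even_subcode n C) - C)"

(* For a nonempty set S of words; the zero word counts if it lies in S. *)
definition min_wt :: "nat \<Rightarrow> (nat \<Rightarrow> klein) set \<Rightarrow> nat" where
  "min_wt n S = Min (wt n ` S)"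

definition gamma1 :: "klein set" where
  "gamma1 = {0, Ka}"

definition code_power :: "klein set \<Rightarrow> nat \<Rightarrow> (nat \<Rightarrow> klein) set" where
  "code_power G n = {x \<in> words n. \<forall>i<n. x i \<in> G}"

(* The map x \<mapsto> (\<lambda>i. \<sigma> i (x (\<pi> i))) preserves words n: for i \<ge> n we have \<pi> i = i, and every \<sigma> i fixes
   0. Only the values of \<sigma> on {..<n} matter, so these maps are exactly the elements of the
   semidirect product of S_3^n and S_n. *)
definition code_equiv :: "nat \<Rightarrow> (nat \<Rightarrow> klein) set \<Rightarrow> (nat \<Rightarrow> klein) set \<Rightarrow> bool" where
  "code_equiv n C D \<longleftrightarrow>
     (\<exists>\<pi> \<sigma>. \<pi> permutes {..<n} \<and> (\<forall>i. \<sigma> i permutes {Ka, Kb, Kc}) \<and>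
            D = (\<lambda>x i. \<sigma> i (x (\<pi> i))) ` C)"

end

theory Submission
  imports Defs
begin

text \<open>
  The weight modulo 2 is additive on a self-dual code \<open>C\<close>, so it is represented by a word \<open>u\<close>, and
  the shadow of a code that is not even consists exactly of these representing words; it is
  nonempty, and it is a coset \<open>u + C\<close>. If all words of the shadow have full weight then
  in every coordinate \<open>C\<close> avoids the nonzero value \<open>u\<^sub>i\<close>, hence takes at most one nonzero value
  \<open>g\<^sub>i\<close> there. The product of the groups \<open>{0, g\<^sub>i}\<close> is orthogonal to \<open>C\<close>, so \<open>C\<close> is this product.
  Conversely, a code equivalent to the power of \<open>\<gamma>\<^sub>1\<close> contains words supported on any single given
  coordinate, and this forces every coordinate of a shadow word to be nonzero.
\<close>

section \<open>Arithmetic of the Kleinian group and its bilinear form\<close>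

lemma klein_add_self [simp]: "x + x = (0 :: klein)"
  by (cases x) (simp_all add: zero_klein_def)

lemma all_klein: "(\<forall>x. Q x) \<longleftrightarrow> Q K0 \<and> Q Ka \<and> Q Kb \<and> Q Kc"
  by (metis klein.exhaust)

lemma ex_klein: "(\<exists>x. Q x) \<longleftrightarrow> Q K0 \<or> Q Ka \<or> Q Kb \<or> Q Kc"
  by (metis klein.exhaust)

lemma klein_add_eq_0_iff: "x + y = 0 \<longleftrightarrow> x = (y :: klein)"
  by (cases x; cases y) (simp_all add: zero_klein_def)

lemma klein_dot_zero [simp]: "klein_dot x 0 = 0" "klein_dot 0 x = 0"
  by (simp_all add: klein_dot_def)

lemma klein_dot_commute: "klein_dot x y = klein_dot y x"
  by (auto simp: klein_dot_def)

lemma klein_dot_add: "klein_dot x (y + z) = klein_dot x y + klein_dot x z"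
  by (cases x; cases y; cases z) (simp_all add: klein_dot_def zero_klein_def)

text \<open>Being nonzero is a quadratic form on \<open>klein\<close> over the two-element field,
  and \<open>klein_dot\<close> is its polar form. Summed over the coordinates, this makes the weight
  modulo 2 additive on orthogonal words.\<close>

lemma of_bool_klein_add:
  "(of_bool (x + y \<noteq> 0) :: bit) = of_bool (x \<noteq> 0) + of_bool (y \<noteq> 0) + klein_dot x y"
  by (cases x; cases y) (simp_all add: klein_dot_def zero_klein_def)

lemma word_prod_add: "word_prod n x (y + z) = word_prod n x y + word_prod n x z"
  by (simp only: word_prod_def plus_fun_apply klein_dot_add sum.distrib)

lemma word_prod_commute: "word_prod n x y = word_prod n y x"
  by (simp add: word_prod_def klein_dot_commute)

section \<open>Weights and their parity\<close>

lemma wt_le: "wt n x \<le> n"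
proof -
  have "card {i. i < n \<and> x i \<noteq> 0} \<le> card {..<n}"
    by (intro card_mono) auto
  then show ?thesis by (simp add: wt_def)
qed

lemma wt_eq_iff: "wt n x = n \<longleftrightarrow> (\<forall>i<n. x i \<noteq> 0)"
proof
  assume "wt n x = n"
  then have "{i. i < n \<and> x i \<noteq> 0} = {..<n}"
    by (intro card_subset_eq) (auto simp: wt_def)
  then show "\<forall>i<n. x i \<noteq> 0" by blast
next
  assume "\<forall>i<n. x i \<noteq> 0"
  then have "{i. i < n \<and> x i \<noteq> 0} = {..<n}" by auto
  then show "wt n x = n" by (simp add: wt_def)
qed

lemma of_nat_wt: "(of_nat (wt n x) :: bit) = (\<Sum>i<n. of_bool (x i \<noteq> 0))"
proof -
  have "{i. i < n \<and> x i \<noteq> 0} = {..<n} \<inter> {i. x i \<noteq> 0}" by auto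
  then show ?thesis by (simp add: wt_def sum.If_cases of_bool_def)
qed

lemma of_nat_wt_eq_0_iff: "(of_nat (wt n x) :: bit) = 0 \<longleftrightarrow> even (wt n x)"
  by (metis bit_2_eq_0 even_of_nat dvd_0_left_iff)

lemma of_nat_wt_add:
  "(of_nat (wt n (x + y)) :: bit) = of_nat (wt n x) + of_nat (wt n y) + word_prod n x y"
  by (simp only: of_nat_wt word_prod_def plus_fun_apply of_bool_klein_add sum.distrib)

section \<open>Representing additive functionals by the form\<close>

lemma klein_functional_represented:
  fixes P :: "klein set" and f :: "klein \<Rightarrow> bit"
  assumes closed: "\<And>x y. x \<in> P \<Longrightarrow> y \<in> P \<Longrightarrow> x + y \<in> P"
    and additive: "\<And>x y. x \<in> P \<Longrightarrow> y \<in> P \<Longrightarrow> f (x + y) = f x + f y"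
  shows "\<exists>v. \<forall>x\<in>P. f x = klein_dot v x"
proof -
  \<comment> \<open>Truth values in place of bits make the claim propositional in the memberships in
    \<open>P\<close> and the values of \<open>p\<close>, once the quantifiers over
    \<open>klein\<close> are expanded.\<close>
  define p where "p k \<longleftrightarrow> f k = 1" for k
  have f: "f k = of_bool (p k)" for k by (cases "f k") (simp_all add: p_def)
  have p_add: "p (x + y) \<longleftrightarrow> p x \<noteq> p y" if "x \<in> P" "y \<in> P" for x y
    using additive[OF that] by (cases "p x"; cases "p y") (simp_all add: f)
  have p0: "K0 \<in> P \<longrightarrow> \<not> p K0"
    using p_add[of K0 K0] by (simp add: zero_klein_def)
  have ab: "Ka \<in> P \<longrightarrow> Kb \<in> P \<longrightarrow> Kc \<in> P \<and> (p Kc \<longleftrightarrow> p Ka \<noteq> p Kb)"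
    using closed[of Ka Kb] p_add[of Ka Kb] by simp
  \<comment> \<open>Two distinct nonzero elements of \<open>P\<close> force the third, so
    \<open>ac\<close> and \<open>bc\<close> lead back to \<open>ab\<close>, which relates the values
    of \<open>p\<close>.\<close>
  have ac: "Ka \<in> P \<longrightarrow> Kc \<in> P \<longrightarrow> Kb \<in> P" using closed[of Ka Kc] by simp
  have bc: "Kb \<in> P \<longrightarrow> Kc \<in> P \<longrightarrow> Ka \<in> P" using closed[of Kb Kc] by simp
  have expand: "(\<forall>x\<in>P. f x = klein_dot v x) \<longleftrightarrow>
      (\<forall>x. x \<in> P \<longrightarrow> (p x \<longleftrightarrow> v \<noteq> K0 \<and> x \<noteq> K0 \<and> v \<noteq> x))" for v
    by (auto simp: f klein_dot_def zero_klein_def)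
  show ?thesis
    unfolding expand ex_klein all_klein simp_thms using p0 ab ac bc klein.distinct by satx
qed

text \<open>The induction splits off the last coordinate. The induction hypothesis handles the words
  vanishing there; the remaining error depends on the last coordinate only and is represented by one
  element of \<open>klein\<close>.\<close>

lemma functional_represented:
  fixes f :: "(nat \<Rightarrow> klein) \<Rightarrow> bit"
  assumes "C \<subseteq> words n"
    and "\<And>x y. x \<in> C \<Longrightarrow> y \<in> C \<Longrightarrow> x + y \<in> C"
    and "\<And>x y. x \<in> C \<Longrightarrow> y \<in> C \<Longrightarrow> f (x + y) = f x + f y"
  shows "\<exists>u\<in>words n. \<forall>x\<in>C. f x = word_prod n u x"
  using assms
proof (induction n arbitrary: C f)
  case 0
  have "f x = 0" if "x \<in> C" for x
  proof -
    have "x + x = x" using "0.prems"(1) that by (auto simp: words_def fun_eq_iff)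
    then have "f x = f x + f x" using "0.prems"(3)[OF that that] by (simp only:)
    then show ?thesis by (cases "f x") simp_all
  qed
  then show ?case by (intro bexI[of _ 0]) (auto simp: word_prod_def words_def)
next
  case (Suc n)
  define C\<^sub>1 where "C\<^sub>1 = {x \<in> C. x n = 0}"
  have "C\<^sub>1 \<subseteq> words n"
  proof
    fix x assume "x \<in> C\<^sub>1"
    then have "x i = 0" if "n \<le> i" for i
      using Suc.prems(1) that by (cases "i = n") (auto simp: C\<^sub>1_def words_def)
    then show "x \<in> words n" by (simp add: words_def)
  qed
  moreover have "x + y \<in> C\<^sub>1" "f (x + y) = f x + f y" if "x \<in> C\<^sub>1" "y \<in> C\<^sub>1" for x y
  proof -
    have xy: "x \<in> C" "y \<in> C" "x n = 0" "y n = 0" using that by (simp_all add: C\<^sub>1_def)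
    show "f (x + y) = f x + f y" by (rule Suc.prems(3)[OF xy(1,2)])
    have "(x + y) n = 0" using xy by simp
    then show "x + y \<in> C\<^sub>1" unfolding C\<^sub>1_def using Suc.prems(2)[OF xy(1,2)] by blast
  qed
  ultimately obtain u where u: "u \<in> words n" "\<forall>x\<in>C\<^sub>1. f x = word_prod n u x"
    using Suc.IH[of C\<^sub>1 f] by blast
  \<comment> \<open>The error of \<open>u\<close>, with plus for minus in characteristic 2. It
    vanishes on \<open>C\<^sub>1\<close>, so it factors through coordinate \<open>n\<close>.\<close>
  define g where "g x = f x + word_prod n u x" for x
  have g_add: "g (x + y) = g x + g y" if "x \<in> C" "y \<in> C" for x y
    unfolding g_def word_prod_add Suc.prems(3)[OF that] by (simp only: ac_simps)
  have g_cong: "g x = g y" if "x \<in> C" "y \<in> C" "x n = y n" for x y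
  proof -
    have "(x + y) n = 0" using that by simp
    then have "x + y \<in> C\<^sub>1" unfolding C\<^sub>1_def using Suc.prems(2)[OF that(1,2)] by blast
    then have "g (x + y) = 0" using u by (simp add: g_def)
    then show ?thesis using g_add[OF that(1,2)] by (cases "g x"; cases "g y") simp_all
  qed
  define P where "P = (\<lambda>x. x n) ` C"
  \<comment> \<open>The map that \<open>g\<close> induces on the projection \<open>P\<close>; by
    \<open>g_cong\<close> the chosen preimage does not affect its value.\<close>
  define k where "k p = g (SOME x. x \<in> C \<and> x n = p)" for p
  have k: "k (x n) = g x" if "x \<in> C" for x
  proof -
    have "(SOME y. y \<in> C \<and> y n = x n) \<in> C \<and> (SOME y. y \<in> C \<and> y n = x n) n = x n"
      by (rule someI[of _ x]) (use that in simp)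
    then show ?thesis unfolding k_def by (intro g_cong) (simp_all add: that)
  qed
  have "p + q \<in> P \<and> k (p + q) = k p + k q" if pq: "p \<in> P" "q \<in> P" for p q
  proof -
    obtain x y where xy: "x \<in> C" "p = x n" "y \<in> C" "q = y n" using pq by (auto simp: P_def)
    have "x + y \<in> C" by (rule Suc.prems(2)[OF xy(1,3)])
    moreover have "p + q = (x + y) n" using xy by simp
    ultimately show ?thesis using k xy g_add[OF xy(1,3)] unfolding P_def by (metis imageI)
  qed
  then obtain v where v: "\<forall>p\<in>P. k p = klein_dot v p"
    using klein_functional_represented[of P k] by blast
  show ?case
  proof (intro bexI ballI)
    show "u(n := v) \<in> words (Suc n)" using u(1) by (auto simp: words_def)
    fix x assume x: "x \<in> C"
    have "klein_dot v (x n) = f x + word_prod n u x"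
      using v k[OF x] x by (auto simp: P_def g_def)
    moreover have "word_prod (Suc n) (u(n := v)) x = word_prod n u x + klein_dot v (x n)"
      by (simp add: word_prod_def)
    ultimately show "f x = word_prod (Suc n) (u(n := v)) x"
      by (cases "f x"; cases "word_prod n u x") simp_all
  qed
qed

section \<open>The shadow of a self-dual code\<close>

lemma mem_shadow_iff:
  assumes "linear_code n C" "self_dual n C" "\<not> even_code n C"
  shows "u \<in> shadow n C \<longleftrightarrow> u \<in> words n \<and> (\<forall>x\<in>C. word_prod n u x = of_nat (wt n x))"
proof -
  have shadow: "shadow n C = dual_code n (even_subcode n C) - C"
    using assms(3) by (simp add: shadow_def)
  have memC: "u \<in> C \<longleftrightarrow> u \<in> words n \<and> (\<forall>x\<in>C. word_prod n u x = 0)" for u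
    using assms(2) by (auto simp: self_dual_def dual_code_def)
  have add: "x + y \<in> C" if "x \<in> C" "y \<in> C" for x y
    using assms(1) that by (simp add: linear_code_def)
  show ?thesis
  proof (intro iffI conjI ballI)
    assume "u \<in> shadow n C"
    then have u: "u \<in> words n" "u \<notin> C" "\<And>x. x \<in> C \<Longrightarrow> even (wt n x) \<Longrightarrow> word_prod n u x = 0"
      by (auto simp: shadow dual_code_def even_subcode_def)
    then show "u \<in> words n" by simp
    \<comment> \<open>As \<open>u\<close> lies outside the self-dual code, some codeword
      \<open>z\<close> is not orthogonal to it, and \<open>z\<close> must be odd. For odd
      \<open>x\<close> the sum \<open>x + z\<close> is even, because \<open>x\<close> and
      \<open>z\<close> are orthogonal; hence \<open>u\<close> has the same product with
      \<open>x\<close> as with \<open>z\<close>.\<close>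
    obtain z where z: "z \<in> C" "word_prod n u z \<noteq> 0" using u memC by blast
    fix x assume x: "x \<in> C"
    show "word_prod n u x = of_nat (wt n x)"
    proof (cases "even (wt n x)")
      case True
      then show ?thesis using u(3) x of_nat_wt_eq_0_iff by metis
    next
      case False
      have "word_prod n x z = 0" using memC x z by blast
      moreover have "odd (wt n z)" using u(3) z by blast
      ultimately have "(of_nat (wt n (x + z)) :: bit) = 0"
        using False of_nat_wt_eq_0_iff[of n x] of_nat_wt_eq_0_iff[of n z]
        by (simp add: of_nat_wt_add)
      then have "word_prod n u (x + z) = 0"
        using u(3)[OF add[OF x z(1)]] of_nat_wt_eq_0_iff by blast
      then show ?thesis
        using z(2) False of_nat_wt_eq_0_iff[of n x]
        by (cases "word_prod n u x") (simp_all add: word_prod_add)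
    qed
  next
    assume u: "u \<in> words n \<and> (\<forall>x\<in>C. word_prod n u x = of_nat (wt n x))"
    \<comment> \<open>The code has an odd word, and a representing word is not orthogonal to
      it.\<close>
    then have "u \<notin> C"
      using assms(3) memC of_nat_wt_eq_0_iff by (metis even_code_def)
    then show "u \<in> shadow n C"
      using u of_nat_wt_eq_0_iff by (auto simp: shadow dual_code_def even_subcode_def)
  qed
qed

text \<open>Ensures that the minimum in \<open>min_wt\<close> is attained. Orthogonality of
  codewords makes parity additive, so \<open>functional_represented\<close> supplies a shadow word
  if the code is not even.\<close>

lemma shadow_nonempty:
  assumes "linear_code n C" "self_dual n C"
  shows "shadow n C \<noteq> {}"
proof (cases "even_code n C")
  case True
  then show ?thesis using assms(1) by (auto simp: shadow_def linear_code_def)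
next
  case False
  have "\<exists>u\<in>words n. \<forall>x\<in>C. (of_nat (wt n x) :: bit) = word_prod n u x"
  proof (rule functional_represented)
    show "C \<subseteq> words n" "\<And>x y. x \<in> C \<Longrightarrow> y \<in> C \<Longrightarrow> x + y \<in> C"
      using assms(1) by (auto simp: linear_code_def)
    fix x y assume "x \<in> C" "y \<in> C"
    then have "word_prod n x y = 0" using assms(2) by (auto simp: self_dual_def dual_code_def)
    then show "(of_nat (wt n (x + y)) :: bit) = of_nat (wt n x) + of_nat (wt n y)"
      by (simp add: of_nat_wt_add)
  qed
  then show ?thesis using mem_shadow_iff[OF assms False] by fastforce
qed

text \<open>Since \<open>c\<close> is orthogonal to the code, \<open>u + c\<close> has the same
  products with codewords as \<open>u\<close> and still represents the parity.\<close>

lemma shadow_add_codeword: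
  assumes "linear_code n C" "self_dual n C" "\<not> even_code n C" "u \<in> shadow n C" "c \<in> C"
  shows "u + c \<in> shadow n C"
proof -
  have "word_prod n x c = 0" if "x \<in> C" for x
    using assms(2,5) that by (auto simp: self_dual_def dual_code_def)
  moreover have "u + c \<in> words n"
    using assms mem_shadow_iff[OF assms(1-3)] by (auto simp: linear_code_def words_def subset_iff)
  ultimately show ?thesis
    using assms(4) unfolding mem_shadow_iff[OF assms(1-3)]
    by (metis word_prod_add word_prod_commute add_0_right)
qed

lemma min_wt_shadow_eq_iff:
  assumes "linear_code n C" "self_dual n C"
  shows "min_wt n (shadow n C) \<le> n"
    and "min_wt n (shadow n C) = n \<longleftrightarrow> (\<forall>u\<in>shadow n C. \<forall>i<n. u i \<noteq> 0)"
proof -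
  let ?W = "wt n ` shadow n C"
  have fin: "finite ?W" by (rule finite_subset[of _ "{..n}"]) (auto simp: wt_le)
  have ne: "?W \<noteq> {}" using shadow_nonempty[OF assms] by simp
  have "Min ?W \<in> ?W" by (rule Min_in[OF fin ne])
  then show le: "min_wt n (shadow n C) \<le> n" by (auto simp: min_wt_def wt_le)
  have "min_wt n (shadow n C) = n \<longleftrightarrow> n \<le> Min ?W" using le by (auto simp: min_wt_def)
  also have "\<dots> \<longleftrightarrow> (\<forall>u\<in>shadow n C. n \<le> wt n u)" using fin ne by simp
  also have "\<dots> \<longleftrightarrow> (\<forall>u\<in>shadow n C. wt n u = n)" by (auto simp: wt_le le_antisym)
  finally show "min_wt n (shadow n C) = n \<longleftrightarrow> (\<forall>u\<in>shadow n C. \<forall>i<n. u i \<noteq> 0)"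
    by (simp add: wt_eq_iff)
qed

section \<open>Codes equivalent to the power of \<open>gamma1\<close>\<close>

lemma code_equiv_gamma1_power_if_single_valued:
  assumes "self_dual n C"
    and g: "\<And>i. i < n \<Longrightarrow> g i \<noteq> 0 \<and> (\<forall>c\<in>C. c i \<in> {0, g i})"
  shows "code_equiv n C (code_power gamma1 n)"
proof -
  \<comment> \<open>Coordinates stay in place; swapping \<open>Ka\<close> with \<open>g i\<close>
    exchanges \<open>{0, g i}\<close> and \<open>gamma1\<close>, and as an involution it also yields
    the preimages.\<close>
  define \<sigma> where "\<sigma> i = (if i < n then transpose Ka (g i) else id)" for i
  have gn: "g i \<in> {Ka, Kb, Kc}" if "i < n" for i
    using g[OF that] by (cases "g i") (auto simp: zero_klein_def)
  have perm: "\<sigma> i permutes {Ka, Kb, Kc}" for i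
    using gn[of i] by (auto simp: \<sigma>_def intro!: permutes_swap_id)
  have \<sigma>0: "\<sigma> i 0 = 0" for i
    using permutes_not_in[OF perm, of 0] by (simp add: zero_klein_def)
  have \<sigma>\<sigma>: "\<sigma> i (\<sigma> i x) = x" for i x by (simp add: \<sigma>_def)
  have \<sigma>g: "\<sigma> i (g i) = Ka" "\<sigma> i Ka = g i" if "i < n" for i
    using that by (simp_all add: \<sigma>_def)
  have words: "x i = 0" if "x \<in> C" "\<not> i < n" for x i
  proof -
    have "x \<in> dual_code n C" using assms(1) that(1) by (simp add: self_dual_def)
    then show ?thesis using that(2) by (simp add: dual_code_def words_def)
  qed
  \<comment> \<open>Two elements of \<open>{0, g i}\<close> are never both nonzero and distinct, so
    every product term vanishes and self-duality gives membership.\<close>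
  have C: "y \<in> C" if "y \<in> words n" "\<And>i. i < n \<Longrightarrow> y i \<in> {0, g i}" for y
  proof -
    have "word_prod n y c = 0" if "c \<in> C" for c
      unfolding word_prod_def
    proof (intro sum.neutral ballI)
      fix i assume "i \<in> {..<n}"
      then have "y i \<in> {0, g i}" "c i \<in> {0, g i}"
        using \<open>\<And>i. i < n \<Longrightarrow> y i \<in> {0, g i}\<close> g that by auto
      then show "klein_dot (y i) (c i) = 0" by (auto simp: klein_dot_def)
    qed
    then have "y \<in> dual_code n C" using that(1) by (simp add: dual_code_def)
    then show ?thesis using assms(1) by (simp add: self_dual_def)
  qed
  have "code_power gamma1 n = (\<lambda>x i. \<sigma> i (x (id i))) ` C"
  proof (intro equalityI subsetI)
    fix y assume y: "y \<in> code_power gamma1 n"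
    have "(\<lambda>i. \<sigma> i (y i)) \<in> C"
    proof (rule C)
      show "(\<lambda>i. \<sigma> i (y i)) \<in> words n" using y by (auto simp: code_power_def words_def \<sigma>0)
      show "\<sigma> i (y i) \<in> {0, g i}" if "i < n" for i
        using y that \<sigma>g by (auto simp: code_power_def gamma1_def \<sigma>0)
    qed
    then show "y \<in> (\<lambda>x i. \<sigma> i (x (id i))) ` C"
      by (rule rev_image_eqI) (simp add: \<sigma>\<sigma>)
  next
    fix y assume "y \<in> (\<lambda>x i. \<sigma> i (x (id i))) ` C"
    then obtain x where x: "x \<in> C" "y = (\<lambda>i. \<sigma> i (x i))" by auto
    have "\<sigma> i (x i) \<in> gamma1" if "i < n" for i
      using g[OF that] x(1) \<sigma>g(1)[OF that] \<sigma>0 unfolding gamma1_def by (metis insert_iff singletonD)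
    then show "y \<in> code_power gamma1 n"
      using words[OF x(1)] by (auto simp: code_power_def words_def x(2) \<sigma>0)
  qed
  then show ?thesis using perm unfolding code_equiv_def by (metis permutes_id)
qed

text \<open>Such words test single coordinates of shadow words. They are pulled back from words with
  a single entry \<open>Ka\<close>, since the maps \<open>\<sigma> i\<close> preserve being
  zero.\<close>

lemma code_equiv_gamma1_power_unit_words:
  assumes "C \<subseteq> words n" "code_equiv n C (code_power gamma1 n)" "j < n"
  obtains x where "x \<in> C" "x j \<noteq> 0" "\<And>i. i \<noteq> j \<Longrightarrow> x i = 0"
proof -
  obtain \<pi> \<sigma> where \<pi>: "\<pi> permutes {..<n}" and \<sigma>: "\<And>i. \<sigma> i permutes {Ka, Kb, Kc}"
    and eq: "code_power gamma1 n = (\<lambda>x i. \<sigma> i (x (\<pi> i))) ` C"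
    using assms(2) unfolding code_equiv_def by blast
  have \<sigma>0: "\<sigma> i y = 0 \<longleftrightarrow> y = 0" for i y
  proof -
    have "\<sigma> i 0 = 0" using permutes_not_in[OF \<sigma>, of 0] by (simp add: zero_klein_def)
    then show ?thesis using permutes_inj[OF \<sigma>, of i] by (metis injD)
  qed
  \<comment> \<open>The image has at position \<open>m\<close> the entry that \<open>x\<close> has
    at \<open>\<pi> m\<close>, so \<open>m\<close> must be the preimage of \<open>j\<close>.\<close>
  define m where "m = inv \<pi> j"
  have m: "\<pi> m = j" "m < n"
    using \<pi> permutes_inverses(1)[OF \<pi>] permutes_in_image[OF permutes_inv[OF \<pi>], of j] assms(3)
    by (auto simp: m_def)
  have "(\<lambda>i. if i = m then Ka else 0) \<in> code_power gamma1 n"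
    using m by (auto simp: code_power_def words_def gamma1_def)
  then obtain x where x: "x \<in> C" "(\<lambda>i. if i = m then Ka else 0) = (\<lambda>i. \<sigma> i (x (\<pi> i)))"
    unfolding eq by blast
  have val: "\<sigma> i (x (\<pi> i)) = (if i = m then Ka else 0)" for i
    using fun_cong[OF x(2), of i] by simp
  show thesis
  proof
    show "x \<in> C" by (rule x(1))
    show "x j \<noteq> 0" using val[of m] \<sigma>0[of m "x j"] m by (auto simp: zero_klein_def)
    fix i assume "i \<noteq> j"
    then have "inv \<pi> i \<noteq> m" using m permutes_inverses(1)[OF \<pi>] by metis
    then show "x i = 0"
      using val[of "inv \<pi> i"] permutes_inverses(1)[OF \<pi>] by (simp add: \<sigma>0)
  qed
qed

section \<open>The bound and its equality case\<close>

theorem theorem13: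
  fixes n :: nat and C :: "(nat \<Rightarrow> klein) set"
  assumes "linear_code n C" and "self_dual n C"
  shows "min_wt n (shadow n C) \<le> n \<and>
    (min_wt n (shadow n C) = n \<longleftrightarrow> code_equiv n C (code_power gamma1 n))"
proof (intro conjI iffI)
  have C: "C \<subseteq> words n" "0 \<in> C" "\<And>x y. x \<in> C \<Longrightarrow> y \<in> C \<Longrightarrow> x + y \<in> C"
    using assms(1) by (auto simp: linear_code_def)
  show "min_wt n (shadow n C) \<le> n" by (rule min_wt_shadow_eq_iff(1)[OF assms])
  {
    assume "min_wt n (shadow n C) = n"
    then have full: "u i \<noteq> 0" if "u \<in> shadow n C" "i < n" for u i
      using min_wt_shadow_eq_iff(2)[OF assms] that by blast
    have "\<exists>g. g \<noteq> 0 \<and> (\<forall>c\<in>C. c i \<in> {0, g})" if i: "i < n" for i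
    proof -
      \<comment> \<open>If the code were even, it would be its own shadow, and its zero word
        vanishes at \<open>i\<close>. For \<open>n = 0\<close> no such \<open>i\<close>
        arises.\<close>
      have ne: "\<not> even_code n C"
        using full[of 0 i] i C(2) by (auto simp: shadow_def)
      obtain u where u: "u \<in> shadow n C" using shadow_nonempty[OF assms] by blast
      have avoid: "c i \<noteq> u i" if "c \<in> C" for c
        using full[OF shadow_add_codeword[OF assms ne u that] i] by (auto simp: klein_add_eq_0_iff)
      \<comment> \<open>A subgroup of \<open>klein\<close> missing a nonzero element
        \<open>r\<close> has at most one nonzero element. Here \<open>r\<close> is
        \<open>u i\<close>, and \<open>p\<close>, \<open>q\<close>, \<open>p + q\<close> are the
        entries of \<open>d\<close>, \<open>c\<close>, \<open>d + c\<close> at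
        \<open>i\<close>.\<close>
      have three: "q \<in> {0, p}"
        if "p \<noteq> 0" "p \<noteq> r" "q \<noteq> r" "p + q \<noteq> r" "r \<noteq> 0" for p q r :: klein
        using that by (cases p; cases q; cases r) (simp_all add: zero_klein_def)
      show ?thesis
      proof (cases "\<forall>c\<in>C. c i = 0")
        case True
        \<comment> \<open>Any nonzero value serves here, and \<open>u i\<close> is one.\<close>
        then show ?thesis using full[OF u i] by auto
      next
        case False
        then obtain d where d: "d \<in> C" "d i \<noteq> 0" by blast
        have "c i \<in> {0, d i}" if "c \<in> C" for c
          using three[of "d i" "u i" "c i"] avoid[OF d(1)] avoid[OF that]
            avoid[OF C(3)[OF d(1) that]] d(2) full[OF u i] by simp
        then show ?thesis using d(2) by blast
      qed
    qed
    then obtain g where "\<And>i. i < n \<Longrightarrow> g i \<noteq> 0 \<and> (\<forall>c\<in>C. c i \<in> {0, g i})" by metis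
    then show "code_equiv n C (code_power gamma1 n)"
      by (rule code_equiv_gamma1_power_if_single_valued[OF assms(2)])
  next
    assume equiv: "code_equiv n C (code_power gamma1 n)"
    have "u j \<noteq> 0" if u: "u \<in> shadow n C" and j: "j < n" for u j
    proof -
      obtain x where x: "x \<in> C" "x j \<noteq> 0" "\<And>i. i \<noteq> j \<Longrightarrow> x i = 0"
        using code_equiv_gamma1_power_unit_words[OF C(1) equiv j] by blast
      have "{i. i < n \<and> x i \<noteq> 0} = {j}" using x j by auto
      \<comment> \<open>A codeword of weight 1 excludes the even case and has product 1 with every
        shadow word, to which only coordinate \<open>j\<close> can contribute.\<close>
      then have wt: "wt n x = 1" by (simp add: wt_def)
      then have ne: "\<not> even_code n C" using x(1) by (force simp: even_code_def)
      have "word_prod n u x = 1" using mem_shadow_iff[OF assms ne] u x(1) wt by simp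
      then have "(\<Sum>i<n. klein_dot (u i) (x i)) \<noteq> 0" by (simp add: word_prod_def)
      then obtain i where "klein_dot (u i) (x i) \<noteq> 0"
        by (rule sum.not_neutral_contains_not_neutral)
      then show ?thesis using x(3)[of i] by (cases "i = j") auto
    qed
    then show "min_wt n (shadow n C) = n" using min_wt_shadow_eq_iff(2)[OF assms] by blast
  }
qed

end
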